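(* For every $n$, let $T$ be a random tournament on $n$ alternatives generated according to the Condorcet random model with parameter $p=p(n)$ satisfying $p \le 0.1\log n/n$. Then with high probability (i.e., with probability tending to $1$ as $n\to\infty$), there exists an alternative in $T$ that is not a $4$-king.
   Context: A tournament on a finite set $V$ of alternatives is a complete orientation: for every two distinct $x,y\in V$ exactly one of $x\succ y$ ("$x$ dominates $y$") or $y\succ x$ holds. For an integer $k\ge 2$, an alternative $x$ is a $k$-king if for every other alternative $y$ there is a directed path from $x$ to $y$ of length (number of edges) at most $k$. Condorcet random model with parameter $0\le p\le 1/2$: alternatives are $x_1,\dots,x_n$; independently for each pair $i<j$, $x_j\succ x_i$ with probability $p$ and $x_i\succ x_j$ with probability $1-p$. $\log$ is the natural logarithm. *)

theory Defs
  imports "HOL-Probability.Probability" "Graph_Theory.Graph_Theory"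
begin

text \<open>An arc \<open>(x, y)\<close> means that \<open>x\<close> dominates \<open>y\<close>.\<close>

locale tournament = pair_digraph T for T :: "'a pair_pre_digraph" +
  assumes complete: "\<lbrakk>x \<in> pverts T; y \<in> pverts T; x \<noteq> y\<rbrakk> \<Longrightarrow>
    ((x, y) \<in> parcs T) \<noteq> ((y, x) \<in> parcs T)"

definition k_king :: "nat \<Rightarrow> 'a pair_pre_digraph \<Rightarrow> 'a \<Rightarrow> bool" where
  "k_king k T x \<longleftrightarrow> x \<in> pverts T \<and>
     (\<forall>y \<in> pverts T - {x}. \<exists>es. pre_digraph.apath (with_proj T) x es y \<and> length es \<le> k)"

definition index_pairs :: "nat \<Rightarrow> (nat \<times> nat) set" where
  "index_pairs n = {(i, j). 1 \<le> i \<and> i < j \<and> j \<le> n}"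

text \<open>
  The alternative \<open>x\<^sub>i\<close> is represented by its index \<open>i\<close>, for \<open>1 \<le> i \<le> n\<close>.
  For \<open>i < j\<close>, \<open>u (i, j)\<close> states that the pair is an upset, i.e. that
  \<open>j\<close> dominates \<open>i\<close>.
\<close>

definition tournament_of_upsets :: "nat \<Rightarrow> (nat \<times> nat \<Rightarrow> bool) \<Rightarrow> nat pair_pre_digraph" where
  "tournament_of_upsets n u =
     \<lparr> pverts = {1..n},
       parcs = {(i, j). (i, j) \<in> index_pairs n \<and> \<not> u (i, j)} \<union>
               {(j, i). (i, j) \<in> index_pairs n \<and> u (i, j)} \<rparr>"

definition condorcet_pmf :: "nat \<Rightarrow> real \<Rightarrow> nat pair_pre_digraph pmf" where
  "condorcet_pmf n p = map_pmf (tournament_of_upsets n)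
     (Pi_pmf (index_pairs n) False (\<lambda>_. bernoulli_pmf p))"

lemma finite_index_pairs: "finite (index_pairs n)"
  by (rule finite_subset[of _ "{1..n} \<times> {1..n}"]) (auto simp: index_pairs_def)

lemma tournament_tournament_of_upsets: "tournament (tournament_of_upsets n u)"
proof
  have "parcs (tournament_of_upsets n u) \<subseteq> {1..n} \<times> {1..n}"
    by (auto simp: tournament_of_upsets_def index_pairs_def)
  then show "finite (parcs (tournament_of_upsets n u))"
    by (rule finite_subset) simp
qed (auto simp: tournament_of_upsets_def index_pairs_def)

lemma tournament_condorcet_pmf: "T \<in> set_pmf (condorcet_pmf n p) \<Longrightarrow> tournament T"
  by (auto simp: condorcet_pmf_def tournament_tournament_of_upsets)

lemma prob_upset_condorcet_pmf:
  assumes "0 \<le> p" "p \<le> 1" "1 \<le> i" "i < j" "j \<le> n"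
  shows "measure_pmf.prob (condorcet_pmf n p) {T. (j, i) \<in> parcs T} = p"
proof -
  have ij: "(i, j) \<in> index_pairs n"
    using assms by (auto simp: index_pairs_def)
  have "tournament_of_upsets n -` {T. (j, i) \<in> parcs T} = (\<lambda>u. u (i, j)) -` {True}"
    using assms by (auto simp: tournament_of_upsets_def index_pairs_def)
  then have "measure_pmf.prob (condorcet_pmf n p) {T. (j, i) \<in> parcs T} =
      measure_pmf.prob (map_pmf (\<lambda>u. u (i, j))
        (Pi_pmf (index_pairs n) False (\<lambda>_. bernoulli_pmf p))) {True}"
    by (simp add: condorcet_pmf_def)
  also have "\<dots> = p"
    using assms(1,2) ij
    by (simp add: Pi_pmf_component finite_index_pairs measure_pmf_single del: measure_map_pmf)
  finally show ?thesis .
qed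

end

theory Submission
  imports Defs "HOL-Real_Asymp.Real_Asymp"
begin

text \<open>
  Consider the \<open>m = \<lceil>n\<^bsup>0.3\<^esup>\<rceil>\<close> first (top) and the \<open>m\<close> last (bottom) alternatives. A bottom
  alternative fails to have an outgoing upset with probability at least \<open>(1 - p)\<^bsup>n\<^esup> \<ge> n\<^bsup>-0.2\<^esup>\<close>,
  independently of the others, so with high probability some bottom \<open>x\<close> has none; symmetrically
  some top \<open>y\<close> has no incoming upset. The expected number of upsets from bottom to top is at most
  \<open>m\<^bsup>2\<^esup> p\<close>, and that of pairs of consecutive upsets leading from bottom to top is at most
  \<open>m\<^bsup>2\<^esup> n p\<^bsup>2\<^esup>\<close>; both tend to 0. When there are none, a path from \<open>x\<close> visits a bottom alternative
  after one step and cannot be at a top one after two or three steps, so its fourth step does not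
  end in \<open>y\<close>, which is dominated by top alternatives only.
\<close>

section \<open>Independence of events on disjoint coordinates of a product distribution\<close>

lemma prob_Pi_pmf_subset:
  assumes "finite A" "A' \<subseteq> A" "\<And>u v. (\<And>x. x \<in> A' \<Longrightarrow> u x = v x) \<Longrightarrow> P u = P v"
  shows "measure_pmf.prob (Pi_pmf A' d q) {u. P u} = measure_pmf.prob (Pi_pmf A d q) {u. P u}"
proof -
  \<comment> \<open>The product over \<open>A'\<close> is the image of the product over
    \<open>A\<close> under resetting all coordinates outside \<open>A'\<close> to \<open>d\<close>;
    \<open>P\<close> does not see this reset.\<close>
  have "P (\<lambda>x. if x \<in> A' then u x else d) = P u" for u
    by (rule assms(3)) auto
  then show ?thesis
    by (simp add: Pi_pmf_subset[OF assms(1,2)] vimage_def)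
qed

text \<open>Cutting both factors down to the countable supports changes no probability and makes
  \<open>measure_pmf_prob_product\<close> applicable.\<close>

lemma measure_pair_pmf_times:
  "measure_pmf.prob (pair_pmf M N) (A \<times> B) = measure_pmf.prob M A * measure_pmf.prob N B"
proof -
  have "measure_pmf.prob (pair_pmf M N) (A \<times> B)
      = measure_pmf.prob (pair_pmf M N) ((A \<times> B) \<inter> set_pmf (pair_pmf M N))"
    by (simp only: measure_Int_set_pmf)
  also have "(A \<times> B) \<inter> set_pmf (pair_pmf M N) = (A \<inter> set_pmf M) \<times> (B \<inter> set_pmf N)"
    by auto
  also have "measure_pmf.prob (pair_pmf M N) \<dots>
      = measure_pmf.prob M (A \<inter> set_pmf M) * measure_pmf.prob N (B \<inter> set_pmf N)"
    by (intro measure_pmf_prob_product countable_Int2 countable_set_pmf)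
  finally show ?thesis
    by (simp add: measure_Int_set_pmf)
qed

text \<open>A sample on \<open>A \<union> B\<close> is a pair of independent samples on
  \<open>A\<close> and on \<open>B\<close> glued together. In a glued sample \<open>P\<close> reads
  only the first component and, by disjointness, \<open>Q\<close> only the second.\<close>

lemma prob_Pi_pmf_indep:
  assumes I: "finite I" "A \<subseteq> I" "B \<subseteq> I" and disj: "A \<inter> B = {}"
    and P: "\<And>u v. (\<And>x. x \<in> A \<Longrightarrow> u x = v x) \<Longrightarrow> P u = P v"
    and Q: "\<And>u v. (\<And>x. x \<in> B \<Longrightarrow> u x = v x) \<Longrightarrow> Q u = Q v"
  shows "measure_pmf.prob (Pi_pmf I d q) {u. P u \<and> Q u}
    = measure_pmf.prob (Pi_pmf I d q) {u. P u} * measure_pmf.prob (Pi_pmf I d q) {u. Q u}"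
proof -
  have fin: "finite A" "finite B"
    using I by (auto intro: finite_subset)
  have glue: "P (\<lambda>x. if x \<in> A then f x else g x) = P f"
    "Q (\<lambda>x. if x \<in> A then f x else g x) = Q g" for f g
    using disj by (auto intro!: P Q)
  have PQ: "(P u \<and> Q u) = (P v \<and> Q v)" if "\<And>x. x \<in> A \<union> B \<Longrightarrow> u x = v x" for u v
    using that P[of u v] Q[of u v] by auto
  have "measure_pmf.prob (Pi_pmf I d q) {u. P u \<and> Q u}
      = measure_pmf.prob (Pi_pmf (A \<union> B) d q) {u. P u \<and> Q u}"
    using I by (intro prob_Pi_pmf_subset[symmetric] PQ) auto
  also have "\<dots> = measure_pmf.prob (pair_pmf (Pi_pmf A d q) (Pi_pmf B d q)) ({u. P u} \<times> {u. Q u})"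
    by (subst Pi_pmf_union[OF fin disj])
      (auto simp: glue intro!: arg_cong[where f = "measure_pmf.prob _"])
  also have "\<dots> = measure_pmf.prob (Pi_pmf A d q) {u. P u} * measure_pmf.prob (Pi_pmf B d q) {u. Q u}"
    by (rule measure_pair_pmf_times)
  also have "measure_pmf.prob (Pi_pmf A d q) {u. P u} = measure_pmf.prob (Pi_pmf I d q) {u. P u}"
    by (rule prob_Pi_pmf_subset[OF I(1,2) P])
  also have "measure_pmf.prob (Pi_pmf B d q) {u. Q u} = measure_pmf.prob (Pi_pmf I d q) {u. Q u}"
    by (rule prob_Pi_pmf_subset[OF I(1,3) Q])
  finally show ?thesis .
qed

section \<open>Independent Bernoulli coordinates\<close>

context
  fixes I :: "'a set" and q :: real and M :: "('a \<Rightarrow> bool) pmf"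
  assumes I: "finite I" and q: "0 \<le> q" "q \<le> 1"
  defines "M \<equiv> Pi_pmf I False (\<lambda>_. bernoulli_pmf q)"
begin

lemma prob_bernoulli_component:
  assumes "e \<in> I"
  shows "measure_pmf.prob M {u. u e} = q"
proof -
  have "measure_pmf.prob M {u. u e} = measure_pmf.prob (map_pmf (\<lambda>u. u e) M) {True}"
    by (auto intro!: arg_cong[where f = "measure_pmf.prob _"])
  also have "\<dots> = q"
    using assms I q by (simp add: M_def Pi_pmf_component measure_pmf_single del: measure_map_pmf)
  finally show ?thesis .
qed

lemma prob_bernoulli_two_components:
  assumes "e \<in> I" "f \<in> I" "e \<noteq> f"
  shows "measure_pmf.prob M {u. u e \<and> u f} = q\<^sup>2"
proof -
  have "measure_pmf.prob M {u. u e \<and> u f}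
      = measure_pmf.prob M {u. u e} * measure_pmf.prob M {u. u f}"
    unfolding M_def by (rule prob_Pi_pmf_indep[of _ "{e}" "{f}"]) (use I assms in auto)
  then show ?thesis
    using assms by (simp add: prob_bernoulli_component power2_eq_square)
qed

lemma prob_bernoulli_some:
  assumes "D \<subseteq> I"
  shows "measure_pmf.prob M {u. \<exists>e\<in>D. u e} = 1 - (1 - q) ^ card D"
proof -
  have fin: "finite D"
    using assms I by (rule finite_subset)
  have "measure_pmf.prob M {u. \<forall>e\<in>D. \<not> u e}
      = measure_pmf.prob (Pi_pmf D False (\<lambda>_. bernoulli_pmf q)) {u. \<forall>e\<in>D. \<not> u e}"
    unfolding M_def by (rule prob_Pi_pmf_subset[symmetric]) (use I assms in auto)
  also have "\<dots> = measure_pmf.prob (Pi_pmf D False (\<lambda>_. bernoulli_pmf q)) (Pi D (\<lambda>_. {False}))"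
    by (rule arg_cong[where f = "measure_pmf.prob _"]) auto
  also have "\<dots> = (1 - q) ^ card D"
    using q by (subst measure_Pi_pmf_Pi[OF fin]) (simp add: measure_pmf_single)
  finally have none: "measure_pmf.prob M {u. \<forall>e\<in>D. \<not> u e} = (1 - q) ^ card D" .
  have "{u. \<exists>e\<in>D. u e} = UNIV - {u. \<forall>e\<in>D. \<not> u e}"
    by auto
  then show ?thesis
    using measure_pmf.prob_compl[of "{u. \<forall>e\<in>D. \<not> u e}" M] none by simp
qed

text \<open>Induction on \<open>K\<close>: the event for a new index depends on \<open>D k\<close>
  alone, hence is independent of the joint event for the others, which depends on the union of their
  sets.\<close>

lemma prob_bernoulli_some_in_each:
  assumes "finite K" "\<And>k. k \<in> K \<Longrightarrow> D k \<subseteq> I" "disjoint_family_on D K"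
  shows "measure_pmf.prob M {u. \<forall>k\<in>K. \<exists>e\<in>D k. u e} = (\<Prod>k\<in>K. 1 - (1 - q) ^ card (D k))"
  using assms
proof (induction K rule: finite_induct)
  case (insert k K)
  have disj: "D k \<inter> (\<Union>j\<in>K. D j) = {}"
    using insert.prems(2) insert.hyps(2) by (auto simp: disjoint_family_on_def)
  have "measure_pmf.prob M {u. (\<exists>e\<in>D k. u e) \<and> (\<forall>j\<in>K. \<exists>e\<in>D j. u e)}
      = measure_pmf.prob M {u. \<exists>e\<in>D k. u e} * measure_pmf.prob M {u. \<forall>j\<in>K. \<exists>e\<in>D j. u e}"
    unfolding M_def
  proof (rule prob_Pi_pmf_indep[OF I _ _ disj])
    show "D k \<subseteq> I" "(\<Union>j\<in>K. D j) \<subseteq> I"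
      using insert.prems(1) by auto
    show "(\<exists>e\<in>D k. u e) = (\<exists>e\<in>D k. v e)" if "\<And>e. e \<in> D k \<Longrightarrow> u e = v e" for u v
      using that by (rule bex_cong[OF refl])
    show "(\<forall>j\<in>K. \<exists>e\<in>D j. u e) = (\<forall>j\<in>K. \<exists>e\<in>D j. v e)"
      if "\<And>e. e \<in> (\<Union>j\<in>K. D j) \<Longrightarrow> u e = v e" for u v
      using that by (intro ball_cong bex_cong refl) blast
  qed
  also have "measure_pmf.prob M {u. \<forall>j\<in>K. \<exists>e\<in>D j. u e} = (\<Prod>k\<in>K. 1 - (1 - q) ^ card (D k))"
    using insert.prems by (intro insert.IH) (auto simp: disjoint_family_on_def)
  finally show ?case
    using insert.hyps insert.prems(1) by (simp add: prob_bernoulli_some)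
qed simp

text \<open>Each factor of the product is at most \<open>1 - (1 - q) ^ n\<close>, and
  \<open>1 + t \<le> exp t\<close> turns the product into a single exponential.\<close>

lemma prob_bernoulli_some_in_each_le:
  assumes "finite K" "\<And>k. k \<in> K \<Longrightarrow> D k \<subseteq> I" "disjoint_family_on D K"
    and card: "\<And>k. k \<in> K \<Longrightarrow> card (D k) \<le> n"
  shows "measure_pmf.prob M {u. \<forall>k\<in>K. \<exists>e\<in>D k. u e} \<le> exp (- (card K * (1 - q) ^ n))"
proof -
  have "measure_pmf.prob M {u. \<forall>k\<in>K. \<exists>e\<in>D k. u e} = (\<Prod>k\<in>K. 1 - (1 - q) ^ card (D k))"
    by (rule prob_bernoulli_some_in_each[OF assms(1-3)])
  also have "\<dots> \<le> (\<Prod>k\<in>K. exp (- ((1 - q) ^ n)))"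
  proof (intro prod_mono conjI)
    fix k assume "k \<in> K"
    then have "(1 - q) ^ n \<le> (1 - q) ^ card (D k)"
      using q card by (intro power_decreasing) auto
    moreover have "1 + - ((1 - q) ^ n) \<le> exp (- ((1 - q) ^ n))"
      by (rule exp_ge_add_one_self)
    ultimately show "1 - (1 - q) ^ card (D k) \<le> exp (- ((1 - q) ^ n))"
      by linarith
    show "0 \<le> 1 - (1 - q) ^ card (D k)"
      using q by (simp add: power_le_one)
  qed
  also have "\<dots> = exp (- (card K * (1 - q) ^ n))"
    by (simp flip: exp_of_nat_mult)
  finally show ?thesis .
qed

end

lemma prob_Bex_le:
  fixes c :: real
  assumes "finite S" "\<And>s. s \<in> S \<Longrightarrow> measure_pmf.prob M {u. P s u} \<le> c"
  shows "measure_pmf.prob M {u. \<exists>s\<in>S. P s u} \<le> card S * c"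
proof -
  have "{u. \<exists>s\<in>S. P s u} = (\<Union>s\<in>S. {u. P s u})"
    by auto
  then have "measure_pmf.prob M {u. \<exists>s\<in>S. P s u} \<le> (\<Sum>s\<in>S. measure_pmf.prob M {u. P s u})"
    using measure_pmf.finite_measure_subadditive_finite[OF assms(1), of "\<lambda>s. {u. P s u}" M] by simp
  also have "\<dots> \<le> card S * c"
    using assms(2) by (rule sum_bounded_above)
  finally show ?thesis .
qed

section \<open>Deterministic conditions under which an alternative is not a 4-king\<close>

lemma parcs_tournament_of_upsets_iff:
  "(a, b) \<in> parcs (tournament_of_upsets n u) \<longleftrightarrow>
    (a, b) \<in> index_pairs n \<and> \<not> u (a, b) \<or> (b, a) \<in> index_pairs n \<and> u (b, a)"
  by (auto simp: tournament_of_upsets_def)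

lemma not_4_king_tournament_of_upsets:
  assumes m: "2 * m \<le> n"
    and x: "n - m < x" "x \<le> n" "\<And>i. 1 \<le> i \<Longrightarrow> i < x \<Longrightarrow> \<not> u (i, x)"
    and y: "1 \<le> y" "y \<le> m" "\<And>j. y < j \<Longrightarrow> j \<le> n \<Longrightarrow> \<not> u (y, j)"
    and single: "\<And>i j. 1 \<le> i \<Longrightarrow> i \<le> m \<Longrightarrow> n - m < j \<Longrightarrow> j \<le> n \<Longrightarrow> \<not> u (i, j)"
    and chain: "\<And>i k j. 1 \<le> i \<Longrightarrow> i \<le> m \<Longrightarrow> i < k \<Longrightarrow> k < j \<Longrightarrow> n - m < j \<Longrightarrow> j \<le> n \<Longrightarrow>
      \<not> (u (i, k) \<and> u (k, j))"
  shows "\<not> k_king 4 (tournament_of_upsets n u) x"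
proof
  let ?T = "tournament_of_upsets n u"
  assume king: "k_king 4 ?T x"
  have "y \<in> pverts ?T - {x}"
    using m x y by (auto simp: tournament_of_upsets_def)
  then obtain es where es: "pre_digraph.apath (with_proj ?T) x es y" "length es \<le> 4"
    using king by (auto simp: k_king_def)
  have cas: "pcas x es y" and arcs: "set es \<subseteq> parcs ?T"
    using es(1) by (simp_all add: pre_digraph.apath_def pre_digraph.awalk_def cas_with_proj_eq)
  have step1: "n - m < a \<and> a \<le> n" if "(x, a) \<in> parcs ?T" for a
    using that x unfolding parcs_tournament_of_upsets_iff by (auto simp: index_pairs_def)
  \<comment> \<open>As \<open>2 * m \<le> n\<close>, an arc from a bottom to a top alternative would
    be an upset, against \<open>single\<close>.\<close>
  have step2: "m < b" if "n - m < a" "a \<le> n" "(a, b) \<in> parcs ?T" for a b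
    using that m single[of b a] unfolding parcs_tournament_of_upsets_iff
    by (auto simp: index_pairs_def simp flip: not_le)
  have step3: "m < c"
    if "n - m < a" "a \<le> n" "(a, b) \<in> parcs ?T" "(b, c) \<in> parcs ?T" for a b c
  proof (rule ccontr)
    assume "\<not> m < c"
    moreover have "m < b"
      using step2 that(1-3) .
    ultimately have c: "c \<le> m" "c < b"
      by auto
    then have cb: "u (c, b)" "1 \<le> c" "b \<le> n"
      using that(4) unfolding parcs_tournament_of_upsets_iff by (auto simp: index_pairs_def)
    \<comment> \<open>By \<open>single\<close>, the source \<open>b\<close> of the upset into
      \<open>c\<close> is not bottom, while \<open>a\<close> is. So the arc from \<open>a\<close> to
      \<open>b\<close> is an upset too, and the two form a forbidden chain.\<close>
    then have "b < a"
      using single[of c b] c that(1) by linarith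
    then have "u (b, a)"
      using that(3) unfolding parcs_tournament_of_upsets_iff by (auto simp: index_pairs_def)
    then show False
      using chain[of c b a] c cb \<open>b < a\<close> that(1,2) by blast
  qed
  have step4: "m \<ge> c" if "(c, y) \<in> parcs ?T" for c
    using that y unfolding parcs_tournament_of_upsets_iff by (auto simp: index_pairs_def)
  consider "es = []" | e1 where "es = [e1]" | e1 e2 where "es = [e1, e2]"
    | e1 e2 e3 where "es = [e1, e2, e3]" | e1 e2 e3 e4 where "es = [e1, e2, e3, e4]"
    using es(2)
    by (auto simp: le_Suc_eq numeral_eq_Suc length_Suc_conv)
  then show False
  \<comment> \<open>Here \<open>snd e1\<close>, \<open>snd e2\<close>, \<open>snd e3\<close> are the
    vertices reached after one, two and three arcs. At length 4, \<open>step3\<close> and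
    \<open>step4\<close> place the third one outside and inside the top block.\<close>
  proof cases
    case 1
    then show False using cas m x y by simp
  next
    case (2 e1)
    then show False using cas arcs m y step1[of y] by (cases e1) auto
  next
    case (3 e1 e2)
    then show False using cas arcs y step1[of "snd e1"] step2[of "snd e1" y]
      by (cases e1; cases e2) auto
  next
    case (4 e1 e2 e3)
    then show False using cas arcs y step1[of "snd e1"] step3[of "snd e1" "snd e2" y]
      by (cases e1; cases e2; cases e3) auto
  next
    case (5 e1 e2 e3 e4)
    then show False using cas arcs step1[of "snd e1"] step3[of "snd e1" "snd e2" "snd e3"] step4[of "snd e3"]
      by (cases e1; cases e2; cases e3; cases e4) auto
  qed
qed

section \<open>Union bound over the four bad events\<close>

lemma prob_not_4_king_ge:
  fixes m n :: nat and q :: real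
  assumes q: "0 \<le> q" "q \<le> 1" and m: "2 * m \<le> n"
  shows "1 - (2 * exp (- (m * (1 - q) ^ n)) + m\<^sup>2 * q + m\<^sup>2 * n * q\<^sup>2)
    \<le> measure_pmf.prob (condorcet_pmf n q) {T. \<exists>x \<in> pverts T. \<not> k_king 4 T x}"
proof -
  define M where "M = Pi_pmf (index_pairs n) False (\<lambda>_. bernoulli_pmf q)"
  \<comment> \<open>The pairs in \<open>out j\<close> are the possible upsets leaving
    \<open>j\<close>, those in \<open>into i\<close> the possible upsets entering
    \<open>i\<close>.\<close>
  define out where "out = (\<lambda>j::nat. (\<lambda>i::nat. (i, j)) ` {1..<j})"
  define into where "into = (\<lambda>i. Pair i ` {i<..n})"
  define chains where "chains = {(i, k, j). i \<in> {1..m} \<and> k \<in> {1..n} \<and> j \<in> {n-m<..n} \<and> i < k \<and> k < j}"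
  define E1 where "E1 = {u. \<forall>j\<in>{n-m<..n}. \<exists>e\<in>out j. u e}"
  define E2 where "E2 = {u. \<forall>i\<in>{1..m}. \<exists>e\<in>into i. u e}"
  define E3 where "E3 = {u. \<exists>e\<in>{1..m} \<times> {n-m<..n}. u e}"
  define E4 where "E4 = {u. \<exists>s\<in>chains. case s of (i, k, j) \<Rightarrow> u (i, k) \<and> u (k, j)}"
  define N where "N = {u. \<exists>x \<in> pverts (tournament_of_upsets n u). \<not> k_king 4 (tournament_of_upsets n u) x}"
  note fin = finite_index_pairs[of n]
  have "- N \<subseteq> E1 \<union> E2 \<union> E3 \<union> E4"
  proof (rule subsetI, rule ccontr)
    fix u assume "u \<in> - N" and nE: "u \<notin> E1 \<union> E2 \<union> E3 \<union> E4"
    obtain x where x: "n - m < x" "x \<le> n" "\<And>i. 1 \<le> i \<Longrightarrow> i < x \<Longrightarrow> \<not> u (i, x)"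
      using nE unfolding E1_def out_def by auto
    obtain y where y: "1 \<le> y" "y \<le> m" "\<And>j. y < j \<Longrightarrow> j \<le> n \<Longrightarrow> \<not> u (y, j)"
      using nE unfolding E2_def into_def by auto
    have "\<not> k_king 4 (tournament_of_upsets n u) x"
    proof (rule not_4_king_tournament_of_upsets[where u = u, OF m x y])
      show "\<not> u (i, j)" if "1 \<le> i" "i \<le> m" "n - m < j" "j \<le> n" for i j
        using nE that by (auto simp: E3_def)
      show "\<not> (u (i, k) \<and> u (k, j))"
        if "1 \<le> i" "i \<le> m" "i < k" "k < j" "n - m < j" "j \<le> n" for i k j
      proof -
        have "(i, k, j) \<in> chains"
          using that by (auto simp: chains_def)
        then show ?thesis
          using nE by (auto simp: E4_def)
      qed
    qed
    then show False
      using \<open>u \<in> - N\<close> x by (auto simp: N_def tournament_of_upsets_def)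
  qed
  then have "measure_pmf.prob M (- N) \<le> measure_pmf.prob M (E1 \<union> E2 \<union> E3 \<union> E4)"
    by (intro measure_pmf.finite_measure_mono) auto
  \<comment> \<open>The events \<open>E1\<close> and \<open>E2\<close> share the pairs joining top
    and bottom; a union bound asks for no independence between them.\<close>
  also have "\<dots> \<le> measure_pmf.prob M E1 + measure_pmf.prob M E2 + measure_pmf.prob M E3
      + measure_pmf.prob M E4"
    by (intro order.trans[OF measure_Un_le] add_mono order.refl) auto
  also have "measure_pmf.prob M E1 \<le> exp (- (card {n-m<..n} * (1 - q) ^ n))"
    unfolding E1_def M_def
    by (rule prob_bernoulli_some_in_each_le[OF fin q])
      (auto simp: out_def index_pairs_def disjoint_family_on_def card_image inj_on_def)
  also have "measure_pmf.prob M E2 \<le> exp (- (card {1..m} * (1 - q) ^ n))"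
    unfolding E2_def M_def
    by (rule prob_bernoulli_some_in_each_le[OF fin q])
      (use m in \<open>auto simp: into_def index_pairs_def disjoint_family_on_def card_image inj_on_def\<close>)
  also have "measure_pmf.prob M E3 \<le> card ({1..m} \<times> {n-m<..n}) * q"
    unfolding E3_def M_def
  proof (rule prob_Bex_le)
    fix e assume "e \<in> {1..m} \<times> {n-m<..n}"
    then have "e \<in> index_pairs n"
      using m by (auto simp: index_pairs_def)
    then show "measure_pmf.prob (Pi_pmf (index_pairs n) False (\<lambda>_. bernoulli_pmf q)) {u. u e} \<le> q"
      by (simp add: prob_bernoulli_component[OF fin q])
  qed simp
  also have "measure_pmf.prob M E4 \<le> (m\<^sup>2 * n) * q\<^sup>2"
  proof -
    have sub: "chains \<subseteq> {1..m} \<times> {1..n} \<times> {n-m<..n}"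
      by (auto simp: chains_def)
    have "measure_pmf.prob M E4 \<le> card chains * q\<^sup>2"
      unfolding E4_def M_def
    proof (rule prob_Bex_le)
      show "finite chains"
        using sub by (rule finite_subset) auto
      show "measure_pmf.prob (Pi_pmf (index_pairs n) False (\<lambda>_. bernoulli_pmf q))
          {u. case s of (i, k, j) \<Rightarrow> u (i, k) \<and> u (k, j)} \<le> q\<^sup>2" if "s \<in> chains" for s
      proof -
        obtain i k j where s: "s = (i, k, j)"
          by (cases s)
        \<comment> \<open>The pairs differ because \<open>i < k\<close>, so the two upsets are
          independent.\<close>
        then have "(i, k) \<in> index_pairs n" "(k, j) \<in> index_pairs n" "(i, k) \<noteq> (k, j)"
          using that by (auto simp: chains_def index_pairs_def)
        with s show ?thesis
          by (simp add: prob_bernoulli_two_components[OF fin q])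
      qed
    qed
    also have "card chains \<le> card ({1..m} \<times> {1..n} \<times> {n-m<..n})"
      using sub by (rule card_mono[rotated]) auto
    also have "\<dots> = m\<^sup>2 * n"
      using m by (simp add: card_cartesian_product power2_eq_square)
    finally show ?thesis
      by (simp add: mult_right_mono)
  qed
  finally have "measure_pmf.prob M (- N)
      \<le> 2 * exp (- (m * (1 - q) ^ n)) + m\<^sup>2 * q + m\<^sup>2 * n * q\<^sup>2"
    using m by (simp add: card_cartesian_product power2_eq_square)
  moreover have "measure_pmf.prob (condorcet_pmf n q) {T. \<exists>x \<in> pverts T. \<not> k_king 4 T x}
      = measure_pmf.prob M N"
    by (simp add: condorcet_pmf_def M_def N_def vimage_def)
  moreover have "measure_pmf.prob M (- N) = 1 - measure_pmf.prob M N"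
    using measure_pmf.prob_compl[of N M] by (simp add: Compl_eq_Diff_UNIV)
  ultimately show ?thesis
    by linarith
qed

section \<open>Asymptotics\<close>

lemma one_minus_power_ge_powr:
  fixes q :: real
  assumes q: "0 \<le> q" "q \<le> 1 / 2" "q \<le> 0.1 * ln n / n" and n: "n \<ge> 1"
  shows "n powr (-0.2) \<le> (1 - q) ^ n"
proof -
  \<comment> \<open>For \<open>q \<le> 1 / 2\<close> the bound \<open>- q - 2 * q\<^sup>2\<close>
    for \<open>ln (1 - q)\<close> is at least \<open>- 2 * q\<close>; this factor 2 turns the
    constant 0.1 into the exponent 0.2.\<close>
  have "2 * q\<^sup>2 \<le> q"
    using mult_left_mono[OF q(2,1)] by (simp add: power2_eq_square)
  then have "- 2 * q \<le> ln (1 - q)"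
    using ln_one_minus_pos_lower_bound[OF q(1,2)] by linarith
  then have "n * (- 2 * q) \<le> n * ln (1 - q)"
    by (intro mult_left_mono) auto
  moreover have "n * q \<le> 0.1 * ln n"
    using q(3) n by (simp add: field_simps)
  ultimately have "-0.2 * ln n \<le> n * ln (1 - q)"
    by linarith
  then have "exp (-0.2 * ln n) \<le> exp (n * ln (1 - q))"
    by simp
  then show ?thesis
    using q n by (simp add: powr_def exp_of_nat_mult)
qed

theorem theorem2:
  fixes p :: "nat \<Rightarrow> real"
  assumes "\<And>n. n \<ge> 1 \<Longrightarrow> 0 \<le> p n \<and> p n \<le> 1 / 2"
    and "\<And>n. n \<ge> 1 \<Longrightarrow> p n \<le> 0.1 * ln (real n) / real n"
  shows "(\<lambda>n. measure_pmf.prob (condorcet_pmf n (p n))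
            {T. \<exists>x \<in> pverts T. \<not> k_king 4 T x}) \<longlonglongrightarrow> 1"
proof (rule tendsto_sandwich)
  define c :: "nat \<Rightarrow> real" where "c = (\<lambda>n. 0.1 * ln n / n)"
  define b :: "nat \<Rightarrow> real" where "b = (\<lambda>n. n powr 0.3 + 1)"
  \<comment> \<open>This is the bound of \<open>prob_not_4_king_ge\<close> with \<open>p n\<close>
    and \<open>m\<close> replaced by explicit estimates. The exponent is of order
    \<open>n powr 0.1\<close>; the other two terms are of order \<open>n powr (-0.4)\<close> up to
    powers of \<open>ln n\<close>.\<close>
  define f where "f = (\<lambda>n. 1 - (2 * exp (- (n powr 0.3 * n powr (-0.2))) + (b n)\<^sup>2 * c n
      + (b n)\<^sup>2 * n * (c n)\<^sup>2))"
  show "f \<longlonglongrightarrow> 1"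
    unfolding f_def b_def c_def by real_asymp
  have "\<forall>\<^sub>F n in sequentially. 2 * b n \<le> n"
    unfolding b_def by real_asymp
  then show "\<forall>\<^sub>F n in sequentially. f n \<le> measure_pmf.prob (condorcet_pmf n (p n))
      {T. \<exists>x \<in> pverts T. \<not> k_king 4 T x}"
    using eventually_ge_at_top[of 1]
  proof eventually_elim
    case (elim n)
    define m where "m = nat \<lceil>n powr 0.3\<rceil>"
    \<comment> \<open>The lower bound controls the exponential term; the upper one, with 1 added for
      rounding, controls the other two terms and gives \<open>2 * m \<le> n\<close>.\<close>
    have m: "n powr 0.3 \<le> m" "m \<le> b n"
      using powr_ge_zero[of "real n" "0.3"] unfolding m_def b_def by linarith+
    have q: "0 \<le> p n" "p n \<le> 1 / 2" "p n \<le> c n"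
      using assms elim(2) by (auto simp: c_def)
    have "n powr 0.3 * n powr (-0.2) \<le> m * (1 - p n) ^ n"
      using m(1) one_minus_power_ge_powr[of "p n" n] q elim(2) by (intro mult_mono) (auto simp: c_def)
    moreover have "m\<^sup>2 * p n \<le> (b n)\<^sup>2 * c n"
      using m q by (simp add: mult_mono power_mono)
    moreover have "m\<^sup>2 * n * (p n)\<^sup>2 \<le> (b n)\<^sup>2 * n * (c n)\<^sup>2"
      unfolding of_nat_mult of_nat_power
      using m q by (intro mult_mono[OF mult_right_mono] power_mono) auto
    ultimately have "f n \<le> 1 - (2 * exp (- (m * (1 - p n) ^ n)) + m\<^sup>2 * p n + m\<^sup>2 * n * (p n)\<^sup>2)"
      unfolding f_def by (intro diff_left_mono add_mono mult_left_mono) auto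
    also have "\<dots> \<le> measure_pmf.prob (condorcet_pmf n (p n)) {T. \<exists>x \<in> pverts T. \<not> k_king 4 T x}"
      using q m elim(1) by (intro prob_not_4_king_ge) auto
    finally show ?case .
  qed
qed auto

end
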